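(* Let $\mu$ be the self-similar measure described in the context, and suppose that $p_i>0$ for every $0\le i\le \ell-1$. Set $B=\{0\le i\le \ell-1 : p_{i+\ell}=0\}$ and $\tilde\tau(q)=\log_\ell\left(\sum_{i\in B}p_i^{\,q}\right)$, with the convention $\tilde\tau(q)=-\infty$ if $B=\emptyset$. Let $T(x)=1-x$ and $\nu=(\mu+\mu\circ T)/2$. Then $$\forall q\in\mathbb{R},\qquad \tau_\mu(q)=\max\left(\tau_\nu(q),\tilde\tau(q)\right).$$
   Context: Let $\ell\ge 2$ be an integer. For $0\le i\le \ell-1$ define $S_i,S_{i+\ell}:[0,1]\to[0,1]$ by $S_i(x)=\frac{x}{\ell}+\frac{i}{\ell}$ and $S_{i+\ell}(x)=-\frac{x}{\ell}+\frac{i+1}{\ell}$. Let $(p_i)_{0\le i\le 2\ell-1}$ be a probability weight ($p_i\ge 0$, $\sum_i p_i=1$), and let $\mu$ be the unique Borel probability measure on $[0,1]$ with $\mu=\sum_{i=0}^{2\ell-1}p_i\,\mu\circ S_i^{-1}$. $\mathcal{F}_n$ is the set of $\ell$-adic intervals $[k/\ell^n,(k+1)/\ell^n)$, $0\le k<\ell^n$. For a probability measure $m$ on $[0,1]$, its $L^q$-spectrum is $\tau_m(q)=\limsup_{n\to\infty}\frac{1}{n\log\ell}\log\left(\sum_{I\in\mathcal{F}_n}m(I)^q\right)$, the sum running over the $I\in\mathcal{F}_n$ with $m(I)\neq 0$. The measure $\mu\circ T$ is $A\mapsto\mu(T(A))$. *)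

theory Defs
  imports "HOL-Probability.Probability"
begin

definition ifs_map :: "nat \<Rightarrow> nat \<Rightarrow> real \<Rightarrow> real" where
  "ifs_map l i x = (if i < l then x / real l + real i / real l
              else - x / real l + (real (i - l) + 1) / real l)"

definition probability_weight :: "nat \<Rightarrow> (nat \<Rightarrow> real) \<Rightarrow> bool" where
  "probability_weight l p \<longleftrightarrow> (\<forall>i<2*l. 0 \<le> p i) \<and> (\<Sum>i<2*l. p i) = 1"

text \<open>A Borel probability measure on the compact interval \<open>[0,1]\<close> is a measure whose space is
  \<open>{0..1}\<close>, not a measure on the whole line.\<close>

definition unit_prob :: "real measure \<Rightarrow> bool" where
  "unit_prob m \<longleftrightarrow> prob_space m \<and> sets m = sets (restrict_space borel {0..1})"

text \<open>The self-similar measure is unique (for \<open>l \<ge> 2\<close> and a probability weight \<open>p\<close>),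
  so it is characterised by this predicate. As the \<open>ifs_map l i\<close> are total functions on the line,
  preimages are intersected with \<open>[0,1]\<close>.\<close>

definition self_similar_measure :: "nat \<Rightarrow> (nat \<Rightarrow> real) \<Rightarrow> real measure \<Rightarrow> bool" where
  "self_similar_measure l p \<mu> \<longleftrightarrow> unit_prob \<mu> \<and>
     (\<forall>A\<in>sets \<mu>. measure \<mu> A = (\<Sum>i<2*l. p i * measure \<mu> (ifs_map l i -` A \<inter> {0..1})))"

definition adic_intervals :: "nat \<Rightarrow> nat \<Rightarrow> real set set" where
  "adic_intervals l n =
     (\<lambda>k. {real k / real l ^ n ..< (real k + 1) / real l ^ n}) ` {..<l ^ n}"

text \<open>The value is an extended real, as the limit superior may be infinite for a general
  measure. The sum is positive unless \<open>m\<close> is the Dirac mass at 1, the only point of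
  \<open>[0,1]\<close> not covered by the intervals; the convention \<open>ln 0 = 0\<close> thus only
  matters in that case.\<close>

definition Lq_spectrum :: "nat \<Rightarrow> real measure \<Rightarrow> real \<Rightarrow> ereal" where
  "Lq_spectrum l m q = limsup (\<lambda>n. ereal (1 / (real n * ln (real l)) *
     ln (\<Sum>I\<in>{I \<in> adic_intervals l n. measure m I \<noteq> 0}. measure m I powr q)))"

definition reflect :: "real \<Rightarrow> real" where
  "reflect x = 1 - x"

definition symmetrization :: "real measure \<Rightarrow> real measure" where
  "symmetrization \<mu> =
     measure_of (space \<mu>) (sets \<mu>) (\<lambda>A. (emeasure \<mu> A + emeasure \<mu> (reflect ` A)) / 2)"

definition unreflected_digits :: "nat \<Rightarrow> (nat \<Rightarrow> real) \<Rightarrow> nat set" where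
  "unreflected_digits l p = {i. i < l \<and> p (i + l) = 0}"

definition tau_tilde :: "nat \<Rightarrow> (nat \<Rightarrow> real) \<Rightarrow> real \<Rightarrow> ereal" where
  "tau_tilde l p q =
     (if unreflected_digits l p = {} then -\<infinity> else ereal (log (real l) (\<Sum>i\<in>unreflected_digits l p. p i powr q)))"

text \<open>The set function in \<open>symmetrization\<close> is countably additive, so \<open>measure_of\<close>
  does not fall back to the zero measure.\<close>

lemma reflect_measurable:
  assumes "unit_prob \<mu>"
  shows "reflect \<in> measurable \<mu> \<mu>"
proof -
  have "reflect \<in> measurable (restrict_space borel {0..1}) (restrict_space borel {0..1})"
    unfolding reflect_def
    by (intro measurable_restrict_space3) auto
  then show ?thesis
    using assms measurable_cong_sets unfolding unit_prob_def by blast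
qed

lemma reflect_image_eq_vimage:
  assumes "unit_prob \<mu>" "A \<in> sets \<mu>"
  shows "reflect ` A = reflect -` A \<inter> space \<mu>"
proof -
  have sp: "space \<mu> = {0..1}"
    using assms(1) sets_eq_imp_space_eq[of \<mu> "restrict_space borel {0..1}"]
    by (simp add: unit_prob_def space_restrict_space)
  have "A \<subseteq> {0..1}"
    using sets.sets_into_space[OF assms(2)] sp by simp
  then show ?thesis
    unfolding sp reflect_def by (force simp: image_iff)
qed

lemma
  assumes "unit_prob \<mu>"
  shows sets_symmetrization: "sets (symmetrization \<mu>) = sets \<mu>"
    and emeasure_symmetrization: "A \<in> sets \<mu> \<Longrightarrow>
      emeasure (symmetrization \<mu>) A = (emeasure \<mu> A + emeasure \<mu> (reflect ` A)) / 2"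
proof -
  show s: "sets (symmetrization \<mu>) = sets \<mu>"
    unfolding symmetrization_def by (simp add: sets.space_closed)
  have im: "emeasure \<mu> (reflect ` A) = emeasure (distr \<mu> \<mu> reflect) A" if "A \<in> sets \<mu>" for A
    using that reflect_measurable[OF assms] reflect_image_eq_vimage[OF assms that]
    by (simp add: emeasure_distr)
  show "emeasure (symmetrization \<mu>) A = (emeasure \<mu> A + emeasure \<mu> (reflect ` A)) / 2"
    if A: "A \<in> sets \<mu>"
  proof (rule emeasure_measure_of[OF symmetrization_def])
    show "sets \<mu> \<subseteq> Pow (space \<mu>)" by (rule sets.space_closed)
    show "A \<in> sets (symmetrization \<mu>)" using A s by simp
    show "positive (sets (symmetrization \<mu>)) (\<lambda>A. (emeasure \<mu> A + emeasure \<mu> (reflect ` A)) / 2)"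
      by (simp add: positive_def)
    show "countably_additive (sets (symmetrization \<mu>))
            (\<lambda>A. (emeasure \<mu> A + emeasure \<mu> (reflect ` A)) / 2)"
    proof (rule countably_additiveI)
      fix F :: "nat \<Rightarrow> real set"
      assume F: "range F \<subseteq> sets (symmetrization \<mu>)" "disjoint_family F"
        "\<Union> (range F) \<in> sets (symmetrization \<mu>)"
      have F': "F i \<in> sets \<mu>" for i using F(1) s by auto
      have "(\<Sum>i. (emeasure \<mu> (F i) + emeasure \<mu> (reflect ` F i)) / 2)
          = (\<Sum>i. (emeasure \<mu> (F i) + emeasure (distr \<mu> \<mu> reflect) (F i)) / 2)"
        using F' im by simp
      also have "\<dots> = ((\<Sum>i. emeasure \<mu> (F i)) + (\<Sum>i. emeasure (distr \<mu> \<mu> reflect) (F i))) / 2"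
        by (simp add: ennreal_suminf_divide suminf_add)
      also have "\<dots> = (emeasure \<mu> (\<Union> (range F)) + emeasure (distr \<mu> \<mu> reflect) (\<Union> (range F))) / 2"
        using F' F(2) by (simp add: suminf_emeasure image_subset_iff)
      also have "\<dots> = (emeasure \<mu> (\<Union> (range F)) + emeasure \<mu> (reflect ` \<Union> (range F))) / 2"
        using F(3) s im by simp
      finally show "(\<Sum>i. (emeasure \<mu> (F i) + emeasure \<mu> (reflect ` F i)) / 2)
          = (emeasure \<mu> (\<Union> (range F)) + emeasure \<mu> (reflect ` \<Union> (range F))) / 2" .
    qed
  qed
qed

end

theory Submission
  imports Defs
begin

text \<open>Write \<open>a\<^sub>n k\<close> for the mass that \<open>\<mu>\<close> gives to the \<open>k\<close>-th \<open>l\<close>-adic interval of level \<open>n\<close>.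
  Since \<open>p 0\<close> and \<open>p (l - 1)\<close> are positive, \<open>\<mu>\<close> does not charge \<open>l\<close>-adic points
  (\<open>adic_point_null\<close>), and self-similarity becomes the recursion (\<open>mass_Suc\<close>)
  \<open>a\<^sub>n\<^sub>+\<^sub>1 (i l\<^sup>n + j) = p i a\<^sub>n j + p (i + l) a\<^sub>n (l\<^sup>n - 1 - j)\<close>,
  while the symmetrization \<open>\<nu>\<close> gives the \<open>k\<close>-th interval the average \<open>b\<^sub>n k\<close> of
  \<open>a\<^sub>n k\<close> and \<open>a\<^sub>n (l\<^sup>n - 1 - k)\<close>. All \<open>a\<^sub>n k\<close> are positive.

  Let \<open>A\<^sub>n\<close> and \<open>N\<^sub>n\<close> be the sums of the \<open>q\<close>-th powers of the \<open>a\<^sub>n k\<close> and of the \<open>b\<^sub>n k\<close>, and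
  let \<open>s\<close> be the sum of \<open>p i powr q\<close> over the digits \<open>i\<close> in \<open>B\<close>, those with \<open>p (i + l) = 0\<close>. In the
  recursion a digit in \<open>B\<close> contributes exactly \<open>p i powr q * A\<^sub>n\<close> to \<open>A\<^sub>n\<^sub>+\<^sub>1\<close>; for any other
  digit both weights are positive, so \<open>p i a + p (i + l) a'\<close> is comparable to \<open>a + a'\<close> and the
  contribution is at most a constant times \<open>N\<^sub>n\<close>. Hence \<open>s A\<^sub>n \<le> A\<^sub>n\<^sub>+\<^sub>1 \<le> s A\<^sub>n + C N\<^sub>n\<close>
  (\<open>moment_Suc_ge\<close>, \<open>moment_Suc_le\<close>). Moreover \<open>N\<^sub>n \<le> 2 A\<^sub>n\<close>, because \<open>b\<^sub>n k\<close> lies between the two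
  masses that it averages (\<open>sym_moment_le\<close>).

  Thus \<open>A\<^sub>n\<close> grows at least as fast as \<open>s\<^sup>n\<close> and as \<open>N\<^sub>n\<close>. Conversely, if \<open>r > s\<close> and
  \<open>N\<^sub>n = O(r\<^sup>n)\<close>, then the upper recursive inequality yields \<open>A\<^sub>n = O(r\<^sup>n)\<close>, so \<open>A\<^sub>n\<close> does not grow
  faster than both.\<close>

section \<open>Exponential growth rates\<close>

text \<open>The upper exponential growth rate, to base \<open>l\<close>, of a sequence of positive reals. An
  \<open>L\<^sup>q\<close>-spectrum is the growth rate of the moment sums. The limit superior ignores the term
  at \<open>n = 0\<close>, which is 0 because of the division by zero.\<close>

definition growth_rate :: "real \<Rightarrow> (nat \<Rightarrow> real) \<Rightarrow> ereal" where
  "growth_rate l u = limsup (\<lambda>n. ereal (1 / (real n * ln l) * ln (u n)))"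

lemma growth_rate_power:
  assumes "1 < l" "0 < s"
  shows "growth_rate l (\<lambda>n. s ^ n) = ereal (log l s)"
proof -
  have "(\<lambda>n. ereal (1 / (real n * ln l) * ln (s ^ n))) \<longlonglongrightarrow> ereal (log l s)"
  proof (rule tendsto_eventually)
    show "\<forall>\<^sub>F n in sequentially. ereal (1 / (real n * ln l) * ln (s ^ n)) = ereal (log l s)"
      using eventually_gt_at_top[of 0]
    proof eventually_elim
      case (elim n)
      then show ?case using assms by (simp add: ln_realpow log_def)
    qed
  qed
  then show ?thesis
    unfolding growth_rate_def by (simp add: lim_imp_Limsup)
qed

lemma growth_rate_leI:
  assumes l: "1 < l" and D: "0 < D"
    and pos: "\<And>n. 0 < u n" and le: "\<And>n. u n \<le> D * (l powr L) ^ n"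
  shows "growth_rate l u \<le> ereal L"
proof -
  have "(\<lambda>n. ln D / ln l * (1 / real n) + L) \<longlonglongrightarrow> ln D / ln l * 0 + L"
    by (intro tendsto_intros lim_1_over_n)
  then have lim: "(\<lambda>n. ereal (ln D / ln l * (1 / real n) + L)) \<longlonglongrightarrow> ereal L"
    by simp
  have "limsup (\<lambda>n. ereal (1 / (real n * ln l) * ln (u n)))
      \<le> limsup (\<lambda>n. ereal (ln D / ln l * (1 / real n) + L))"
  proof (rule Limsup_mono)
    show "\<forall>\<^sub>F n in sequentially. ereal (1 / (real n * ln l) * ln (u n))
        \<le> ereal (ln D / ln l * (1 / real n) + L)"
      using eventually_gt_at_top[of 0]
    proof eventually_elim
      case (elim n)
      have "ln (u n) \<le> ln (D * (l powr L) ^ n)"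
        using pos[of n] le[of n] by simp
      also have "\<dots> = ln D + real n * (L * ln l)"
        using D l by (simp add: ln_mult ln_realpow ln_powr)
      finally have "1 / (real n * ln l) * ln (u n)
          \<le> 1 / (real n * ln l) * (ln D + real n * (L * ln l))"
        using l elim by (intro mult_left_mono) auto
      also have "\<dots> = ln D / ln l * (1 / real n) + L"
        using l elim by (simp add: field_simps)
      finally show ?case by simp
    qed
  qed
  also have "\<dots> = ereal L"
    using lim by (simp add: lim_imp_Limsup)
  finally show ?thesis
    unfolding growth_rate_def .
qed

lemma growth_rate_lessD:
  assumes l: "1 < l" and pos: "\<And>n. 0 < u n" and less: "growth_rate l u < ereal L"
  obtains K where "0 < K" "\<And>n. u n \<le> K * (l powr L) ^ n"
proof -
  have "\<forall>\<^sub>F n in sequentially. ereal (1 / (real n * ln l) * ln (u n)) < ereal L"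
    using less unfolding growth_rate_def by (rule Limsup_lessD)
  then obtain m where m: "\<And>n. m \<le> n \<Longrightarrow> 1 / (real n * ln l) * ln (u n) < L"
    by (auto simp: eventually_sequentially)
  let ?r = "l powr L"
  \<comment> \<open>The finitely many early terms are absorbed by the constant.\<close>
  define K where "K = 1 + (\<Sum>n\<le>m. u n / ?r ^ n)"
  have r: "0 < ?r" using l by simp
  have sum_nonneg: "0 \<le> (\<Sum>n\<le>m. u n / ?r ^ n)"
    using pos r by (intro sum_nonneg) (simp add: less_imp_le)
  have "u n \<le> K * ?r ^ n" for n
  proof (cases "n \<le> m")
    case True
    have "u n / ?r ^ n \<le> (\<Sum>n\<le>m. u n / ?r ^ n)"
      using True pos r by (intro member_le_sum) (auto simp: less_imp_le)
    then have "u n / ?r ^ n \<le> K"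
      unfolding K_def by simp
    then show ?thesis
      using r by (simp add: pos_divide_le_eq)
  next
    case False
    then have n: "0 < n" "m \<le> n" by auto
    have "ln (u n) < L * (real n * ln l)"
      using m[OF n(2)] n(1) l by (simp add: field_simps)
    then have "ln (u n) < ln (?r ^ n)"
      using l by (simp add: ln_realpow ln_powr mult_ac)
    then have "u n < ?r ^ n"
      using pos r by simp
    also have "\<dots> \<le> K * ?r ^ n"
      using sum_nonneg r by (simp add: K_def)
    finally show ?thesis by simp
  qed
  moreover have "0 < K"
    using sum_nonneg by (simp add: K_def)
  ultimately show ?thesis
    using that by blast
qed

lemma ereal_le_if_real_greater:
  fixes x y :: ereal
  assumes "\<And>L. y < ereal L \<Longrightarrow> x \<le> ereal L"
  shows "x \<le> y"
proof (rule dense_ge)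
  fix z assume "y < z"
  then show "x \<le> z"
    using assms by (cases z) auto
qed

lemma growth_rate_mono:
  assumes l: "1 < l" and C: "0 < C"
    and u: "\<And>n. 0 < u n" and v: "\<And>n. 0 < v n" and le: "\<And>n. u n \<le> C * v n"
  shows "growth_rate l u \<le> growth_rate l v"
proof (rule ereal_le_if_real_greater)
  fix L assume "growth_rate l v < ereal L"
  then obtain K where K: "0 < K" "\<And>n. v n \<le> K * (l powr L) ^ n"
    using growth_rate_lessD[of l v L] l v by blast
  have "u n \<le> (C * K) * (l powr L) ^ n" for n
  proof -
    have "C * v n \<le> C * (K * (l powr L) ^ n)"
      using K(2) C by (intro mult_left_mono) auto
    then show ?thesis
      using le[of n] by (simp add: mult.assoc)
  qed
  then show "growth_rate l u \<le> ereal L"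
    using growth_rate_leI[of l "C * K" u L] l u C K(1) by simp
qed

lemma growth_rate_recursion_le:
  assumes l: "1 < l" and s: "0 \<le> s" and C: "0 \<le> C"
    and u: "\<And>n. 0 < u n" and v: "\<And>n. 0 < v n"
    and rec: "\<And>n. u (Suc n) \<le> s * u n + C * v n"
    and vL: "growth_rate l v < ereal L" and sL: "s < l powr L"
  shows "growth_rate l u \<le> ereal L"
proof -
  let ?r = "l powr L"
  obtain K where K: "0 < K" "\<And>n. v n \<le> K * ?r ^ n"
    using growth_rate_lessD[OF l v vL] by blast
  \<comment> \<open>The induction step asks for \<open>C K \<le> D (r - s)\<close>, the base case for \<open>u 0 \<le> D\<close>.\<close>
  define D where "D = u 0 + C * K / (?r - s)"
  have gap: "0 < ?r - s" using sL by simp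
  then have "0 \<le> C * K / (?r - s)" using C K(1) by simp
  then have D: "0 < D" "u 0 \<le> D"
    using u[of 0] by (auto simp: D_def)
  have "D * (?r - s) = u 0 * (?r - s) + C * K"
    using gap by (simp add: D_def distrib_right)
  then have D_gap: "C * K \<le> D * (?r - s)"
    using u[of 0] gap by simp
  have "u n \<le> D * ?r ^ n" for n
  proof (induction n)
    case 0
    then show ?case using D by simp
  next
    case (Suc n)
    have "u (Suc n) \<le> s * (D * ?r ^ n) + C * (K * ?r ^ n)"
      using rec[of n] mult_left_mono[OF Suc s] mult_left_mono[OF K(2)[of n] C] by linarith
    also have "\<dots> = (s * D + C * K) * ?r ^ n"
      by (simp add: algebra_simps)
    also have "\<dots> \<le> (D * ?r) * ?r ^ n"
      using D_gap by (intro mult_right_mono) (auto simp: algebra_simps)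
    finally show ?case by (simp add: mult_ac)
  qed
  then show ?thesis
    using growth_rate_leI[of l D u L] l D(1) u by blast
qed

section \<open>Masses of adic intervals\<close>

text \<open>The \<open>k\<close>-th \<open>l\<close>-adic interval of level \<open>n\<close>, counted from the left and from 0; it lies in
  \<open>[0,1)\<close> exactly for \<open>k < l\<^sup>n\<close>, and reflection of the unit interval takes it to the one of
  index \<open>l\<^sup>n - 1 - k\<close>, up to endpoints.\<close>

definition adic_interval :: "nat \<Rightarrow> nat \<Rightarrow> nat \<Rightarrow> real set" where
  "adic_interval l n k = {real k / real l ^ n ..< (real k + 1) / real l ^ n}"

text \<open>The exponent may have either sign: the power is increasing or decreasing in its base, and in
  both cases it is bounded by its value at one of the two ends.\<close>

lemma powr_le_powr_ends_sum:
  fixes x :: real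
  assumes "0 < u" "u \<le> x" "x \<le> v"
  shows "x powr q \<le> u powr q + v powr q"
proof (cases "0 \<le> q")
  case True
  then have "x powr q \<le> v powr q"
    using assms by (intro powr_mono2) auto
  then show ?thesis by (simp add: add_increasing)
next
  case False
  then have "x powr q \<le> u powr q"
    using assms by (intro powr_mono2') auto
  then show ?thesis by (simp add: add_increasing2)
qed

lemma sum_lessThan_mult:
  fixes f :: "nat \<Rightarrow> 'a::comm_monoid_add"
  shows "sum f {..<m * n} = (\<Sum>i<m. \<Sum>j<n. f (i * n + j))"
proof -
  have "sum f {i * n..<i * n + n} = (\<Sum>j<n. f (i * n + j))" for i
    using sum.shift_bounds_nat_ivl[of f 0 "i * n" n]
    by (simp add: add.commute atLeast0LessThan)
  then show ?thesis
    using sum.nat_group[of f n m] by simp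
qed

text \<open>A self-similar measure whose unreflected maps all have positive weight; the reflected ones
  may have weight 0.\<close>

locale positive_self_similar =
  fixes l :: nat and p :: "nat \<Rightarrow> real" and \<mu> :: "real measure"
  assumes l2: "2 \<le> l"
    and weight: "probability_weight l p"
    and self_similar: "self_similar_measure l p \<mu>"
    and p_pos: "i < l \<Longrightarrow> 0 < p i"
begin

lemma unit_prob: "unit_prob \<mu>"
  using self_similar by (simp add: self_similar_measure_def)

sublocale prob_space \<mu>
  using unit_prob by (simp add: unit_prob_def)

lemma sets_eq: "sets \<mu> = sets (restrict_space borel {0..1})"
  using unit_prob by (simp add: unit_prob_def)

lemma space_eq: "space \<mu> = {0..1}"
  using sets_eq_imp_space_eq[OF sets_eq] by (simp add: space_restrict_space)

lemma in_sets_iff: "A \<in> sets \<mu> \<longleftrightarrow> A \<in> sets borel \<and> A \<subseteq> {0..1}"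
  by (simp add: sets_eq sets_restrict_space_iff conj_commute)

lemma measure_self_similar:
  "A \<in> sets \<mu> \<Longrightarrow> measure \<mu> A = (\<Sum>i<2*l. p i * measure \<mu> (ifs_map l i -` A \<inter> {0..1}))"
  using self_similar by (simp add: self_similar_measure_def)

lemma p_nonneg: "i < 2 * l \<Longrightarrow> 0 \<le> p i"
  using weight by (simp add: probability_weight_def)

lemma sum_p: "(\<Sum>i<2*l. p i) = 1"
  using weight by (simp add: probability_weight_def)

text \<open>The inverse of the \<open>i\<close>-th map, as a function on the whole line.\<close>

definition ifs_inv :: "nat \<Rightarrow> real \<Rightarrow> real" where
  "ifs_inv i y = (if i < l then real l * y - real i else real (i - l) + 1 - real l * y)"

lemma ifs_map_eq_iff: "ifs_map l i x = y \<longleftrightarrow> x = ifs_inv i y"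
proof -
  have l0: "0 < real l" using l2 by simp
  show ?thesis
  proof (cases "i < l")
    case True
    then show ?thesis using l0 by (auto simp: ifs_map_def ifs_inv_def field_simps)
  next
    case False
    have "ifs_map l i x = (real (i - l) + 1 - x) / real l"
      using False by (simp add: ifs_map_def diff_divide_distrib)
    then show ?thesis using False l0 by (auto simp: ifs_inv_def nonzero_divide_eq_eq algebra_simps)
  qed
qed

lemma ifs_vimage_singleton: "ifs_map l i -` {y} = {ifs_inv i y}"
  using ifs_map_eq_iff by blast

lemma measure_singleton:
  assumes "y \<in> {0..1}"
  shows "measure \<mu> {y} = (\<Sum>i<2*l. p i * measure \<mu> {ifs_inv i y})"
proof -
  have "measure \<mu> ({ifs_inv i y} \<inter> {0..1}) = measure \<mu> {ifs_inv i y}" for i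
    by (cases "ifs_inv i y \<in> {0..1}") (simp_all add: measure_notin_sets in_sets_iff)
  moreover have "{y} \<in> sets \<mu>"
    using assms by (simp add: in_sets_iff)
  ultimately show ?thesis
    by (simp add: measure_self_similar ifs_vimage_singleton del: Int_insert_left_if0 Int_insert_left_if1)
qed

text \<open>If 0 or 1 were an atom, the heavier of the two would have to be mapped into itself or into
  the other one by the inverse of every map of positive weight, but the inverse of the last
  unreflected map expels 0 from the unit interval and that of the first one expels 1.\<close>

lemma endpoint_null: "measure \<mu> {0} = 0" "measure \<mu> {1} = 0"
proof -
  define M where "M = max (measure \<mu> {0}) (measure \<mu> {1})"
  have M0: "0 \<le> M" by (simp add: M_def le_max_iff_disj)
  have int: "measure \<mu> {of_int z} \<le> M" for z
  proof (cases "of_int z \<in> {0..1::real}")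
    case True
    then have "z = 0 \<or> z = 1" by auto
    then show ?thesis by (auto simp: M_def)
  next
    case False
    then show ?thesis using M0 by (simp add: measure_notin_sets in_sets_iff)
  qed
  have bound: "measure \<mu> {y} \<le> (1 - p d) * M"
    if y: "y \<in> {0, 1}" and d: "d < l" "ifs_inv d y \<notin> {0..1}" for y d
  proof -
    have d2: "d \<in> {..<2 * l}" using d by simp
    have le: "measure \<mu> {ifs_inv i y} \<le> M" for i
    proof -
      have "\<exists>z. ifs_inv i y = of_int z"
        using y by (auto simp: ifs_inv_def intro: exI[of _ "- int i"] exI[of _ "int (i - l) + 1"]
            exI[of _ "int l - int i"] exI[of _ "int (i - l) + 1 - int l"])
      then show ?thesis using int by auto
    qed
    have "measure \<mu> {y} = (\<Sum>i<2*l. p i * measure \<mu> {ifs_inv i y})"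
      using y by (intro measure_singleton) auto
    also have "\<dots> = p d * measure \<mu> {ifs_inv d y}
        + (\<Sum>i\<in>{..<2*l} - {d}. p i * measure \<mu> {ifs_inv i y})"
      using d2 by (intro sum.remove) auto
    also have "\<dots> = (\<Sum>i\<in>{..<2*l} - {d}. p i * measure \<mu> {ifs_inv i y})"
      using d by (simp add: measure_notin_sets in_sets_iff)
    also have "\<dots> \<le> (\<Sum>i\<in>{..<2*l} - {d}. p i * M)"
      using le p_nonneg by (intro sum_mono mult_left_mono) auto
    also have "\<dots> = (1 - p d) * M"
      using sum.remove[of "{..<2*l}" d p] d2 sum_p by (simp add: sum_distrib_right[symmetric])
    finally show ?thesis .
  qed
  have "measure \<mu> {0} \<le> (1 - p (l - 1)) * M" "measure \<mu> {1} \<le> (1 - p 0) * M"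
    using l2 by (auto intro!: bound simp: ifs_inv_def)
  then have "M \<le> (1 - p (l - 1)) * M \<or> M \<le> (1 - p 0) * M"
    unfolding M_def by (auto simp: max_def)
  then have "p (l - 1) * M \<le> 0 \<or> p 0 * M \<le> 0"
    by (simp add: algebra_simps)
  then have "M \<le> 0"
    using p_pos[of "l - 1"] p_pos[of 0] l2 by (auto simp: mult_le_0_iff)
  then show "measure \<mu> {0} = 0" "measure \<mu> {1} = 0"
    by (auto simp: M_def intro!: antisym)
qed

text \<open>The maps \<^const>\<open>ifs_inv\<close> lower the level of an adic point by one, so that self-similarity
  reduces the claim to integers, of which only 0 and 1 lie in the unit interval. Points outside it
  need no separate hypothesis, since their singletons are not measurable and get the value 0.\<close>

lemma adic_point_null: "measure \<mu> {of_int k / real l ^ n} = 0"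
proof (induction n arbitrary: k)
  case 0
  show ?case
  proof (cases "of_int k \<in> {0..1::real}")
    case True
    then have "k = 0 \<or> k = 1" by auto
    then show ?thesis using endpoint_null by auto
  next
    case False
    then show ?thesis by (simp add: measure_notin_sets in_sets_iff)
  qed
next
  case (Suc n)
  let ?y = "of_int k / real l ^ Suc n"
  show ?case
  proof (cases "?y \<in> {0..1}")
    case True
    have "measure \<mu> {ifs_inv i ?y} = 0" for i
    proof -
      have "ifs_inv i ?y = of_int (k - int i * int l ^ n) / real l ^ n" if "i < l"
        using that l2 by (simp add: ifs_inv_def field_simps)
      moreover have "ifs_inv i ?y = of_int ((int (i - l) + 1) * int l ^ n - k) / real l ^ n"
        if "\<not> i < l"
        using that l2 by (simp add: ifs_inv_def field_simps)
      ultimately show ?thesis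
        using Suc.IH by (metis (no_types))
    qed
    then show ?thesis
      using measure_singleton[OF True] by simp
  next
    case False
    then show ?thesis by (simp add: measure_notin_sets in_sets_iff)
  qed
qed

text \<open>The mass of an adic interval, as a function of its level and its index.\<close>

definition mass :: "nat \<Rightarrow> nat \<Rightarrow> real" where
  "mass n k = measure \<mu> (adic_interval l n k)"

lemma scaled_mem_unit:
  assumes "k < l ^ n"
  shows "(real k + 1) / real l ^ n \<le> 1"
proof -
  have "real k + 1 \<le> real (l ^ n)" using assms by linarith
  then show ?thesis using l2 by simp
qed

lemma adic_interval_subset: "k < l ^ n \<Longrightarrow> adic_interval l n k \<subseteq> {0..1}"
  using scaled_mem_unit[of k n] order_trans[of 0 "real k / real l ^ n"]
  by (auto simp: adic_interval_def)

lemma adic_interval_sets: "k < l ^ n \<Longrightarrow> adic_interval l n k \<in> sets \<mu>"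
  using adic_interval_subset by (simp add: in_sets_iff adic_interval_def)

lemma mass_left_open:
  assumes "k < l ^ n"
  shows "measure \<mu> {real k / real l ^ n <.. (real k + 1) / real l ^ n} = mass n k"
proof -
  let ?a = "real k / real l ^ n" and ?b = "(real k + 1) / real l ^ n"
  have ab: "0 \<le> ?a" "?a < ?b" "?b \<le> 1"
    using l2 scaled_mem_unit[OF assms] by (auto simp: divide_strict_right_mono)
  have null: "measure \<mu> {?a} = 0" "measure \<mu> {?b} = 0"
    using adic_point_null[of "int k" n] adic_point_null[of "int k + 1" n] by auto
  have sets: "{?a<..<?b} \<in> sets \<mu>" "{?a} \<in> sets \<mu>" "{?b} \<in> sets \<mu>"
    using ab order_trans[OF ab(1)] by (auto simp: in_sets_iff)
  have "{?a<..?b} = {?a<..<?b} \<union> {?b}" "adic_interval l n k = {?a<..<?b} \<union> {?a}"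
    using ab by (auto simp: adic_interval_def)
  then show ?thesis
    using sets null by (simp add: mass_def finite_measure_Union del: Un_insert_right)
qed

lemma reversed_interval_eq:
  assumes "k < l ^ n"
  shows "{1 - (real k + 1) / real l ^ n <.. 1 - real k / real l ^ n}
    = {real (l ^ n - 1 - k) / real l ^ n <.. (real (l ^ n - 1 - k) + 1) / real l ^ n}"
proof -
  have "real (l ^ n - 1 - k) = real l ^ n - 1 - real k"
    using assms by (simp add: of_nat_diff Suc_leI)
  then have "1 - (real k + 1) / real l ^ n = real (l ^ n - 1 - k) / real l ^ n"
    "1 - real k / real l ^ n = (real (l ^ n - 1 - k) + 1) / real l ^ n"
    using l2 by (simp_all add: field_simps del: of_nat_diff)
  then show ?thesis by (simp only:)
qed

lemma mass_reversed:
  assumes "k < l ^ n"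
  shows "measure \<mu> {1 - (real k + 1) / real l ^ n <.. 1 - real k / real l ^ n}
    = mass n (l ^ n - 1 - k)"
  using assms mass_left_open[of "l ^ n - 1 - k" n]
  by (simp only: reversed_interval_eq)

text \<open>The preimage of the interval under the two maps with image \<open>[i/l, (i+1)/l]\<close> is, up to its
  endpoints, an interval of the previous level; for every other map its part in the unit interval
  contains at most an endpoint of the unit interval.\<close>

lemma mass_Suc:
  assumes i: "i < l" and j: "j < l ^ n"
  shows "mass (Suc n) (i * l ^ n + j) = p i * mass n j + p (i + l) * mass n (l ^ n - 1 - j)"
proof -
  define I where "I = adic_interval l (Suc n) (i * l ^ n + j)"
  define h where "h m = measure \<mu> (ifs_map l m -` I \<inter> {0..1})" for m
  have l0: "0 < real l" using l2 by simp
  have "i * l ^ n + j < Suc i * l ^ n" using j by simp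
  also have "\<dots> \<le> l * l ^ n" using i by (intro mult_right_mono) auto
  finally have k: "i * l ^ n + j < l ^ Suc n" by simp
  have mem: "y \<in> I \<longleftrightarrow> real l * y - real i \<in> adic_interval l n j" for y
    using l0 unfolding I_def adic_interval_def by (simp add: field_simps)
  have unit: "adic_interval l n j \<subseteq> {0..<1}"
    using scaled_mem_unit[OF j] order_trans[of 0 "real j / real l ^ n"]
    by (auto simp: adic_interval_def)
  have scale: "real l * ifs_map l m x = (if m < l then x + real m else real (m - l) + 1 - x)" for m x
    using l0 by (simp add: ifs_map_def field_simps)
  have "ifs_map l i -` I \<inter> {0..1} = adic_interval l n j"
    using unit i by (auto simp: mem scale)
  then have h_i: "h i = mass n j"
    by (simp add: h_def mass_def)
  have "ifs_map l (i + l) -` I \<inter> {0..1}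
      = {1 - (real j + 1) / real l ^ n <.. 1 - real j / real l ^ n}"
    using scaled_mem_unit[OF j] order_trans[OF _ diff_left_mono[of 0 "real j / real l ^ n" 1]]
    by (auto simp: mem scale adic_interval_def)
  then have h_il: "h (i + l) = mass n (l ^ n - 1 - j)"
    using mass_reversed[OF j] by (simp add: h_def)
  have h_0: "h m = 0" if m: "m \<noteq> i" "m \<noteq> i + l" for m
  proof -
    have "x = 0 \<or> x = 1" if x: "ifs_map l m x \<in> I" "0 \<le> x" "x \<le> 1" for x
    proof -
      have z: "0 \<le> real l * ifs_map l m x - real i" "real l * ifs_map l m x - real i < 1"
        using x(1) unit by (auto simp: mem)
      show ?thesis
      proof (cases "m < l")
        case True
        then have z': "real i \<le> x + real m" "x + real m < real i + 1"
          using z by (auto simp: scale)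
        then have "m < i" using m(1) x by linarith
        then have "x = 1" using z' x by linarith
        then show ?thesis ..
      next
        case False
        then have z': "real i \<le> real (m - l) + 1 - x" "real (m - l) - x < real i"
          using z by (auto simp: scale)
        have "m - l \<noteq> i" using False m(2) by linarith
        then have "m - l < i" using z' x by linarith
        then have "x = 0" using z' x by linarith
        then show ?thesis ..
      qed
    qed
    then have sub: "ifs_map l m -` I \<inter> {0..1} \<subseteq> {0} \<union> {1}" by fastforce
    have "h m \<le> measure \<mu> ({0} \<union> {1})"
      unfolding h_def using sub by (intro finite_measure_mono) (auto simp: in_sets_iff)
    also have "\<dots> = measure \<mu> {0} + measure \<mu> {1}"
      by (rule finite_measure_Union) (auto simp: in_sets_iff)
    finally show ?thesis
      using endpoint_null by (simp add: h_def measure_le_0_iff)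
  qed
  have "mass (Suc n) (i * l ^ n + j) = (\<Sum>m<2*l. p m * h m)"
    unfolding mass_def h_def I_def using adic_interval_sets[OF k] by (rule measure_self_similar)
  also have "\<dots> = (\<Sum>m\<in>{i, i + l}. p m * h m)"
    using i h_0 by (intro sum.mono_neutral_right) auto
  also have "\<dots> = p i * h i + p (i + l) * h (i + l)"
    using l2 by simp
  finally show ?thesis
    by (simp add: h_i h_il)
qed

lemma mass_0: "mass 0 0 = 1"
proof -
  have "{0..1} = {0..<1::real} \<union> {1}" by auto
  then have "measure \<mu> {0..1} = measure \<mu> {0..<1} + measure \<mu> {1}"
    by (simp add: finite_measure_Union in_sets_iff del: Un_insert_right)
  then show ?thesis
    using prob_space endpoint_null by (simp add: mass_def adic_interval_def space_eq)
qed

lemma mass_pos: "k < l ^ n \<Longrightarrow> 0 < mass n k"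
proof (induction n arbitrary: k)
  case 0
  then show ?case by (simp add: mass_0)
next
  case (Suc n)
  define i where "i = k div l ^ n"
  define j where "j = k mod l ^ n"
  have i: "i < l" and j: "j < l ^ n"
    using Suc.prems l2 by (auto simp: i_def j_def less_mult_imp_div_less)
  have "0 < p i * mass n j"
    using p_pos[OF i] Suc.IH[OF j] by simp
  moreover have "0 \<le> p (i + l) * mass n (l ^ n - 1 - j)"
    using p_nonneg[of "i + l"] i by (simp add: mass_def)
  moreover have "k = i * l ^ n + j"
    unfolding i_def j_def by (rule div_mult_mod_eq[symmetric])
  ultimately show ?case
    using mass_Suc[OF i j] by simp
qed

lemma mass_reversed_pos: "k < l ^ n \<Longrightarrow> 0 < mass n (l ^ n - Suc k)"
  by (rule mass_pos) simp

section \<open>Moment sums of the measure and of its symmetrization\<close>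

text \<open>The mass that the symmetrized measure gives to an adic interval
  (see \<open>measure_symmetrization\<close>).\<close>

definition sym_mass :: "nat \<Rightarrow> nat \<Rightarrow> real" where
  "sym_mass n k = (mass n k + mass n (l ^ n - 1 - k)) / 2"

lemma sym_mass_pos: "k < l ^ n \<Longrightarrow> 0 < sym_mass n k"
  using mass_pos[of k n] mass_reversed_pos[of k n] by (simp add: sym_mass_def)

lemma measure_symmetrization:
  assumes k: "k < l ^ n"
  shows "measure (symmetrization \<mu>) (adic_interval l n k) = sym_mass n k"
proof -
  let ?I = "adic_interval l n k"
  have "reflect ` ?I = {1 - (real k + 1) / real l ^ n <.. 1 - real k / real l ^ n}"
    unfolding reflect_def adic_interval_def image_diff_atLeastLessThan ..
  then have refl: "measure \<mu> (reflect ` ?I) = mass n (l ^ n - 1 - k)"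
    using mass_reversed[OF k] by simp
  have "emeasure (symmetrization \<mu>) ?I = (emeasure \<mu> ?I + emeasure \<mu> (reflect ` ?I)) / 2"
    by (rule emeasure_symmetrization[OF unit_prob adic_interval_sets[OF k]])
  also have "\<dots> = ennreal (sym_mass n k)"
    using mass_pos[OF k] mass_reversed_pos[OF k] divide_ennreal[of "mass n k + mass n (l ^ n - 1 - k)" 2]
    by (simp add: emeasure_eq_measure refl mass_def[symmetric] sym_mass_def)
  finally show ?thesis
    using sym_mass_pos[OF k] by (simp add: measure_def)
qed

lemma Lq_spectrum_eq_growth_rate:
  assumes m: "\<And>n k. k < l ^ n \<Longrightarrow> measure m (adic_interval l n k) = f n k"
    and pos: "\<And>n k. k < l ^ n \<Longrightarrow> 0 < f n k"
  shows "Lq_spectrum l m q = growth_rate (real l) (\<lambda>n. \<Sum>k<l ^ n. f n k powr q)"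
proof -
  have "(\<Sum>I\<in>{I \<in> adic_intervals l n. measure m I \<noteq> 0}. measure m I powr q)
      = (\<Sum>k<l ^ n. f n k powr q)" for n
  proof -
    have img: "adic_intervals l n = adic_interval l n ` {..<l ^ n}"
      by (simp add: adic_intervals_def adic_interval_def)
    have "measure m I \<noteq> 0" if "I \<in> adic_intervals l n" for I
      using that m[of _ n] pos[of _ n] by (fastforce simp: img)
    then have "{I \<in> adic_intervals l n. measure m I \<noteq> 0} = adic_interval l n ` {..<l ^ n}"
      using img by blast
    moreover have "inj_on (adic_interval l n) {..<l ^ n}"
    proof (rule inj_onI)
      fix a b assume eq: "adic_interval l n a = adic_interval l n b"
      have lt: "real k / real l ^ n < (real k + 1) / real l ^ n" for k
        using l2 by (simp add: divide_strict_right_mono)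
      show "a = b"
        using eq lt[of a] lt[of b] l2 by (simp add: adic_interval_def Ico_eq_Ico)
    qed
    ultimately show ?thesis
      using m by (simp add: sum.reindex)
  qed
  then show ?thesis
    by (simp add: Lq_spectrum_def growth_rate_def)
qed

context
  fixes q :: real
begin

text \<open>The sums of the \<open>q\<close>-th powers of the masses that the measure and its symmetrization give to
  the adic intervals of level \<open>n\<close>.\<close>

definition moment :: "nat \<Rightarrow> real" where
  "moment n = (\<Sum>k<l ^ n. mass n k powr q)"

definition sym_moment :: "nat \<Rightarrow> real" where
  "sym_moment n = (\<Sum>k<l ^ n. sym_mass n k powr q)"

text \<open>The factor by which the digits without reflected counterpart multiply \<^const>\<open>moment\<close>; its
  logarithm is the threshold \<^const>\<open>tau_tilde\<close>.\<close>

definition unreflected_factor :: real where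
  "unreflected_factor = (\<Sum>i\<in>unreflected_digits l p. p i powr q)"

lemma Lq_spectrum_measure: "Lq_spectrum l \<mu> q = growth_rate (real l) moment"
  unfolding moment_def by (intro Lq_spectrum_eq_growth_rate mass_pos) (simp_all add: mass_def)

lemma Lq_spectrum_symmetrization:
  "Lq_spectrum l (symmetrization \<mu>) q = growth_rate (real l) sym_moment"
  unfolding sym_moment_def
  by (intro Lq_spectrum_eq_growth_rate sym_mass_pos) (simp_all add: measure_symmetrization)

lemma moment_pos: "0 < moment n"
  unfolding moment_def using mass_pos[of _ n] l2
  by (intro sum_pos) (auto simp: lessThan_empty_iff less_imp_neq[symmetric])

lemma sym_moment_pos: "0 < sym_moment n"
  unfolding sym_moment_def using sym_mass_pos[of _ n] l2
  by (intro sum_pos) (auto simp: lessThan_empty_iff less_imp_neq[symmetric])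

lemma sym_moment_le: "sym_moment n \<le> 2 * moment n"
proof -
  have "sym_mass n k powr q \<le> mass n k powr q + mass n (l ^ n - Suc k) powr q" if "k < l ^ n" for k
  proof -
    let ?a = "mass n k" and ?b = "mass n (l ^ n - Suc k)"
    have pos: "0 < ?a" "0 < ?b"
      using that by (auto intro: mass_pos mass_reversed_pos)
    have "sym_mass n k powr q \<le> min ?a ?b powr q + max ?a ?b powr q"
      using pos by (intro powr_le_powr_ends_sum) (auto simp: sym_mass_def)
    also have "\<dots> = ?a powr q + ?b powr q"
      by (simp add: min_def max_def)
    finally show ?thesis .
  qed
  then have "sym_moment n \<le> (\<Sum>k<l ^ n. mass n k powr q + mass n (l ^ n - Suc k) powr q)"
    unfolding sym_moment_def by (intro sum_mono) auto
  also have "\<dots> = 2 * moment n"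
    using sum.nat_diff_reindex[of "\<lambda>k. mass n k powr q" "l ^ n"]
    by (simp add: sum.distrib moment_def)
  finally show ?thesis .
qed

text \<open>The part of the moment sum of level \<open>n + 1\<close> that comes from the intervals inside
  \<open>[i/l, (i+1)/l)\<close>.\<close>

definition digit_moment :: "nat \<Rightarrow> nat \<Rightarrow> real" where
  "digit_moment n i =
    (\<Sum>j<l ^ n. (p i * mass n j + p (i + l) * mass n (l ^ n - 1 - j)) powr q)"

lemma moment_Suc: "moment (Suc n) = (\<Sum>i<l. digit_moment n i)"
  by (simp add: moment_def digit_moment_def sum_lessThan_mult mass_Suc)

lemma unreflected_subset: "unreflected_digits l p \<subseteq> {..<l}"
  by (auto simp: unreflected_digits_def)

lemma digit_moment_unreflected:
  assumes "i \<in> unreflected_digits l p"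
  shows "digit_moment n i = p i powr q * moment n"
proof -
  have i: "i < l" "p (i + l) = 0"
    using assms by (auto simp: unreflected_digits_def)
  have "(p i * mass n j) powr q = p i powr q * mass n j powr q" if "j < l ^ n" for j
    using p_pos[OF i(1)] mass_pos[OF that] by (simp add: powr_mult)
  then show ?thesis
    using i(2) by (simp add: digit_moment_def moment_def sum_distrib_left)
qed

text \<open>A combination of two masses with weights \<open>p i\<close> and \<open>p (i + l)\<close> lies between the smaller and
  the larger weight times the sum of the masses, which is twice their average. The sign of \<open>q\<close> decides
  which of the two bounds is relevant, so both enter the constant.\<close>

lemma digit_moment_reflected:
  assumes i: "i < l" "i \<notin> unreflected_digits l p"
  shows "digit_moment n i
    \<le> ((2 * min (p i) (p (i + l))) powr q + (2 * max (p i) (p (i + l))) powr q) * sym_moment n"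
proof -
  let ?c = "min (p i) (p (i + l))" and ?C = "max (p i) (p (i + l))"
  have "p (i + l) \<noteq> 0" "0 \<le> p (i + l)"
    using i p_nonneg[of "i + l"] by (auto simp: unreflected_digits_def)
  then have pos: "0 < p i" "0 < p (i + l)"
    using p_pos[OF i(1)] by auto
  have "(p i * mass n j + p (i + l) * mass n (l ^ n - 1 - j)) powr q
      \<le> ((2 * ?c) powr q + (2 * ?C) powr q) * sym_mass n j powr q" if j: "j < l ^ n" for j
  proof -
    let ?a = "mass n j" and ?b = "mass n (l ^ n - 1 - j)"
    have ab: "0 < ?a" "0 < ?b"
      using j by (auto intro: mass_pos mass_reversed_pos)
    have two: "2 * x * sym_mass n j = x * ?a + x * ?b" for x
      by (simp add: sym_mass_def algebra_simps)
    have "?c * ?a \<le> p i * ?a" "?c * ?b \<le> p (i + l) * ?b"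
      "p i * ?a \<le> ?C * ?a" "p (i + l) * ?b \<le> ?C * ?b"
      using ab by (auto intro!: mult_right_mono)
    then have "2 * ?c * sym_mass n j \<le> p i * ?a + p (i + l) * ?b"
      "p i * ?a + p (i + l) * ?b \<le> 2 * ?C * sym_mass n j"
      unfolding two by linarith+
    moreover have "0 < 2 * ?c * sym_mass n j"
      using pos sym_mass_pos[OF j] by simp
    ultimately have "(p i * ?a + p (i + l) * ?b) powr q
        \<le> (2 * ?c * sym_mass n j) powr q + (2 * ?C * sym_mass n j) powr q"
      by (intro powr_le_powr_ends_sum)
    also have "\<dots> = ((2 * ?c) powr q + (2 * ?C) powr q) * sym_mass n j powr q"
      using pos sym_mass_pos[OF j] by (simp add: powr_mult algebra_simps)
    finally show ?thesis .
  qed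
  then show ?thesis
    unfolding digit_moment_def sym_moment_def sum_distrib_left by (intro sum_mono) auto
qed

lemma moment_Suc_split:
  "moment (Suc n) = unreflected_factor * moment n
    + (\<Sum>i\<in>{..<l} - unreflected_digits l p. digit_moment n i)"
proof -
  have "moment (Suc n) = (\<Sum>i\<in>{..<l} - unreflected_digits l p. digit_moment n i)
      + (\<Sum>i\<in>unreflected_digits l p. digit_moment n i)"
    unfolding moment_Suc by (rule sum.subset_diff[OF unreflected_subset]) simp
  then show ?thesis
    by (simp add: digit_moment_unreflected unreflected_factor_def sum_distrib_right)
qed

lemma moment_Suc_ge: "unreflected_factor * moment n \<le> moment (Suc n)"
  by (simp add: moment_Suc_split digit_moment_def sum_nonneg)

lemma moment_Suc_le:
  obtains C where "0 \<le> C" "\<And>n. moment (Suc n) \<le> unreflected_factor * moment n + C * sym_moment n"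
proof
  let ?K = "\<lambda>i. (2 * min (p i) (p (i + l))) powr q + (2 * max (p i) (p (i + l))) powr q"
  let ?C = "\<Sum>i\<in>{..<l} - unreflected_digits l p. ?K i"
  show "0 \<le> ?C" by (intro sum_nonneg) auto
  show "moment (Suc n) \<le> unreflected_factor * moment n + ?C * sym_moment n" for n
    unfolding moment_Suc_split sum_distrib_right
    using digit_moment_reflected[of _ n] by (intro add_left_mono sum_mono) auto
qed

lemma unreflected_factor_nonneg: "0 \<le> unreflected_factor"
  by (simp add: unreflected_factor_def sum_nonneg)

lemma unreflected_factor_pos:
  assumes "unreflected_digits l p \<noteq> {}"
  shows "0 < unreflected_factor"
  unfolding unreflected_factor_def
proof (rule sum_pos)
  show "finite (unreflected_digits l p)"
    using unreflected_subset by (rule finite_subset) simp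
  show "0 < p i powr q" if "i \<in> unreflected_digits l p" for i
    using p_pos[of i] that by (simp add: unreflected_digits_def)
qed (rule assms)

lemma tau_tilde_eq: "unreflected_digits l p \<noteq> {} \<Longrightarrow> tau_tilde l p q = ereal (log l unreflected_factor)"
  by (simp add: tau_tilde_def unreflected_factor_def)

lemma power_le_moment: "unreflected_factor ^ n \<le> moment n"
proof (induction n)
  case 0
  then show ?case by (simp add: moment_def mass_0)
next
  case (Suc n)
  then show ?case
    using moment_Suc_ge[of n] mult_left_mono[OF Suc unreflected_factor_nonneg] by simp
qed

theorem spectrum_eq_max:
  "Lq_spectrum l \<mu> q = max (Lq_spectrum l (symmetrization \<mu>) q) (tau_tilde l p q)"
proof (rule antisym)
  have l1: "1 < real l" using l2 by simp
  show "max (Lq_spectrum l (symmetrization \<mu>) q) (tau_tilde l p q) \<le> Lq_spectrum l \<mu> q"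
  proof (rule max.boundedI)
    show "Lq_spectrum l (symmetrization \<mu>) q \<le> Lq_spectrum l \<mu> q"
      unfolding Lq_spectrum_measure Lq_spectrum_symmetrization
      by (rule growth_rate_mono[OF l1 _ sym_moment_pos moment_pos sym_moment_le]) simp
    show "tau_tilde l p q \<le> Lq_spectrum l \<mu> q"
    proof (cases "unreflected_digits l p = {}")
      case True
      then show ?thesis by (simp add: tau_tilde_def)
    next
      case False
      note pos = unreflected_factor_pos[OF False]
      have "growth_rate (real l) (\<lambda>n. unreflected_factor ^ n) \<le> growth_rate (real l) moment"
        using pos power_le_moment by (intro growth_rate_mono[OF l1, of 1] moment_pos) auto
      then show ?thesis
        by (simp add: growth_rate_power[OF l1 pos] tau_tilde_eq[OF False] Lq_spectrum_measure)
    qed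
  qed
  obtain C where C: "0 \<le> C"
    "\<And>n. moment (Suc n) \<le> unreflected_factor * moment n + C * sym_moment n"
    by (rule moment_Suc_le) blast
  show "Lq_spectrum l \<mu> q \<le> max (Lq_spectrum l (symmetrization \<mu>) q) (tau_tilde l p q)"
  proof (rule ereal_le_if_real_greater)
    fix L assume "max (Lq_spectrum l (symmetrization \<mu>) q) (tau_tilde l p q) < ereal L"
    then have L: "growth_rate (real l) sym_moment < ereal L" "tau_tilde l p q < ereal L"
      by (simp_all add: Lq_spectrum_symmetrization)
    have "unreflected_factor < real l powr L"
    proof (cases "unreflected_digits l p = {}")
      case True
      then show ?thesis using l1 by (simp add: unreflected_factor_def)
    next
      case False
      then show ?thesis
        using L(2) l1 unreflected_factor_pos[OF False] by (simp add: tau_tilde_eq log_less_iff)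
    qed
    then show "Lq_spectrum l \<mu> q \<le> ereal L"
      unfolding Lq_spectrum_measure
      by (rule growth_rate_recursion_le[OF l1 unreflected_factor_nonneg C(1) moment_pos
            sym_moment_pos C(2) L(1)])
  qed
qed

end

end

section \<open>The spectrum of the self-similar measure\<close>

theorem theorem4p2:
  fixes l :: nat and p :: "nat \<Rightarrow> real" and \<mu> :: "real measure"
  assumes "l \<ge> 2"
    and "probability_weight l p"
    and "self_similar_measure l p \<mu>"
    and "\<forall>i<l. p i > 0"
  shows "\<forall>q::real. Lq_spectrum l \<mu> q =
           max (Lq_spectrum l (symmetrization \<mu>) q) (tau_tilde l p q)"
proof -
  interpret positive_self_similar l p \<mu>
    using assms by unfold_locales auto
  show ?thesis
    using spectrum_eq_max by blast
qed

end
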